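(* Let $f:\mathbb{R}^n\to\mathbb{R}^n$ and $g:\mathbb{R}^n\to\mathbb{R}^{n\times m}$ be continuous, let $\varepsilon\in(0,1)$, $\alpha\in[0,1]$, let $\Sigma_w\in\mathbb{R}^{n\times n}$ be symmetric positive definite, and let $\mathcal{P}$ be the set of all probability distributions on $\mathbb{R}^n$ with mean $0$ and covariance matrix $\Sigma_w$. Let $q\in\mathbb{R}^n$, $r\in\mathbb{R}$ and $h(x)=q^\top x+r$. For $x\in\mathbb{R}^n$ and $u\in\mathbb{R}^m$, write $x^+=f(x)+g(x)u+w$, where $w$ is a random vector in $\mathbb{R}^n$ with law $\mathbb{P}\in\mathcal{P}$. Then for every $x\in\mathbb{R}^n$ and $u\in\mathbb{R}^m$, the constraint $$\sup_{\mathbb{P}\in\mathcal{P}}\mathbb{P}\text{-CVaR}_{\varepsilon}[-h(x^+)]\le-\alpha h(x)$$ holds if and only if $$-q^\top g(x)u\le\phi(x),$$ where $$\phi(x)=q^\top(f(x)-\alpha x)+(1-\alpha)r-\sup_{\mathbb{P}\in\mathcal{P}}\mathbb{P}\text{-CVaR}_{\varepsilon}[q^\top w].$$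
   Context: For a measurable loss function $L:\mathbb{R}^n\to\mathbb{R}$, a probability distribution $\mathbb{P}$ on $\mathbb{R}^n$ (the law of the random vector $w$) and a level $\varepsilon\in(0,1)$, the Conditional Value-at-Risk is $$\mathbb{P}\text{-CVaR}_{\varepsilon}[L(w)]=\inf_{\beta\in\mathbb{R}}\left\{\beta+\frac1\varepsilon\,\mathbb{E}_{\mathbb{P}}\big[(L(w)-\beta)^+\big]\right\},$$ where $(a)^+=\max(a,0)$. The worst-case CVaR over $\mathcal{P}$ is the supremum of this quantity over $\mathbb{P}\in\mathcal{P}$. In $\text{CVaR}_\varepsilon[-h(x^+)]$ the vectors $x,u$ are deterministic and only $w$ is random. *)

theory Defs
  imports "HOL-Probability.Probability"
begin

definition pos_def_mat :: "real^'n^'n \<Rightarrow> bool" where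
  "pos_def_mat S \<longleftrightarrow> transpose S = S \<and> (\<forall>v. v \<noteq> 0 \<longrightarrow> v \<bullet> (S *v v) > 0)"

(* The integrability conditions are needed because the Bochner integral of a
   non-integrable function is 0. *)
definition has_mean :: "(real^'n) measure \<Rightarrow> real^'n \<Rightarrow> bool" where
  "has_mean P \<mu> \<longleftrightarrow> integrable P (\<lambda>w. w) \<and> (\<integral>w. w \<partial>P) = \<mu>"

definition has_covariance :: "(real^'n) measure \<Rightarrow> real^'n^'n \<Rightarrow> bool" where
  "has_covariance P S \<longleftrightarrow>
     (let \<mu> = (\<integral>w. w \<partial>P) in
      \<forall>i j. integrable P (\<lambda>w. (w $ i - \<mu> $ i) * (w $ j - \<mu> $ j)) \<and>
            (\<integral>w. (w $ i - \<mu> $ i) * (w $ j - \<mu> $ j) \<partial>P) = S $ i $ j)"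

definition ambiguity_set :: "real^'n^'n \<Rightarrow> (real^'n) measure set" where
  "ambiguity_set S =
     {P. prob_space P \<and> sets P = sets borel \<and> has_mean P 0 \<and> has_covariance P S}"

(* The expectation of the nonnegative variable (L - \<beta>)^+ is a Lebesgue integral with
   values in [0, \<infinity>], so the infimum, and the supremum below, are taken in the
   extended reals and need no side conditions on boundedness or integrability. *)
definition cvar :: "(real^'n) measure \<Rightarrow> real \<Rightarrow> (real^'n \<Rightarrow> real) \<Rightarrow> ereal" where
  "cvar P \<epsilon> L =
     (INF \<beta>::real. ereal \<beta> +
        ereal (1 / \<epsilon>) * enn2ereal (\<integral>\<^sup>+w. ennreal (max (L w - \<beta>) 0) \<partial>P))"

definition wc_cvar :: "(real^'n) measure set \<Rightarrow> real \<Rightarrow> (real^'n \<Rightarrow> real) \<Rightarrow> ereal" where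
  "wc_cvar \<P> \<epsilon> L = (SUP P\<in>\<P>. cvar P \<epsilon> L)"

definition next_state ::
  "(real^'n \<Rightarrow> real^'n) \<Rightarrow> (real^'n \<Rightarrow> real^'m^'n) \<Rightarrow> real^'n \<Rightarrow> real^'m \<Rightarrow> real^'n \<Rightarrow> real^'n" where
  "next_state f g x u w = f x + g x *v u + w"

end

(* The ambiguity set is invariant under the reflection w \<mapsto> -w, so the worst-case CVaR of
   -q \<bullet> w equals that of q \<bullet> w; everything else in the loss -h(x\<^sup>+) is a constant, which
   CVaR passes through additively. *)
theory Submission
  imports Defs
begin

text \<open>Substituting \<open>\<beta> + c\<close> for \<open>\<beta>\<close> leaves the excess
  \<open>L w - \<beta>\<close> unchanged and adds \<open>c\<close> to the objective. One inequality
  suffices, because \<open>c\<close> may have either sign.\<close>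

lemma cvar_add_const_le:
  "cvar P \<epsilon> (\<lambda>w. L w + c) \<le> ereal c + cvar P \<epsilon> L"
proof -
  \<comment> \<open>With the finite \<open>c\<close> on the left, the right side is a bare infimum,
    which can be bounded below one \<open>\<beta>\<close> at a time.\<close>
  have "cvar P \<epsilon> (\<lambda>w. L w + c) - ereal c \<le> cvar P \<epsilon> L"
    unfolding cvar_def[of P \<epsilon> L]
  proof (rule INF_greatest)
    fix \<beta> :: real
    have shift: "ereal (\<beta> + c) + y = (ereal \<beta> + y) + ereal c" for y
      by (cases y) auto
    have "cvar P \<epsilon> (\<lambda>w. L w + c) \<le> ereal (\<beta> + c) +
        ereal (1 / \<epsilon>) * enn2ereal (\<integral>\<^sup>+w. ennreal (max (L w + c - (\<beta> + c)) 0) \<partial>P)"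
      unfolding cvar_def by (rule INF_lower) simp
    also have "\<dots> = (ereal \<beta> +
        ereal (1 / \<epsilon>) * enn2ereal (\<integral>\<^sup>+w. ennreal (max (L w - \<beta>) 0) \<partial>P)) + ereal c"
      unfolding add_diff_cancel_right by (rule shift)
    finally show "cvar P \<epsilon> (\<lambda>w. L w + c) - ereal c \<le> ereal \<beta> +
        ereal (1 / \<epsilon>) * enn2ereal (\<integral>\<^sup>+w. ennreal (max (L w - \<beta>) 0) \<partial>P)"
      by (simp add: ereal_minus_le)
  qed
  then show ?thesis
    by (simp add: ereal_minus_le add.commute)
qed

lemma cvar_add_const:
  "cvar P \<epsilon> (\<lambda>w. L w + c) = cvar P \<epsilon> L + ereal c"
proof (rule antisym)
  show "cvar P \<epsilon> (\<lambda>w. L w + c) \<le> cvar P \<epsilon> L + ereal c"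
    using cvar_add_const_le[of P \<epsilon> L c] by (simp add: add.commute)
  \<comment> \<open>The reverse direction is the same inequality for the loss \<open>L w + c\<close>
    shifted by \<open>- c\<close>.\<close>
  have "cvar P \<epsilon> L \<le> ereal (- c) + cvar P \<epsilon> (\<lambda>w. L w + c)"
    using cvar_add_const_le[of P \<epsilon> "\<lambda>w. L w + c" "- c"] by simp
  then show "cvar P \<epsilon> L + ereal c \<le> cvar P \<epsilon> (\<lambda>w. L w + c)"
    by (cases "cvar P \<epsilon> L"; cases "cvar P \<epsilon> (\<lambda>w. L w + c)") auto
qed

text \<open>An upper bound on a supremum is a bound for each law \<open>P\<close>, so the constant
  crosses the inequality law by law, also where a CVaR is infinite.\<close>

lemma wc_cvar_add_const_le_iff:
  "wc_cvar \<P> \<epsilon> (\<lambda>w. L w + c) \<le> ereal a \<longleftrightarrow> wc_cvar \<P> \<epsilon> L \<le> ereal (a - c)"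
proof -
  have "y + ereal c \<le> ereal a \<longleftrightarrow> y \<le> ereal (a - c)" for y
    by (cases y) auto
  then show ?thesis
    by (simp add: wc_cvar_def SUP_le_iff cvar_add_const)
qed

text \<open>Negation fixes the mean 0, and the two signs cancel in each product
  \<open>w $ i * w $ j\<close>.\<close>

lemma distr_uminus_ambiguity_set:
  assumes "P \<in> ambiguity_set S"
  shows "distr P borel uminus \<in> ambiguity_set S"
proof -
  interpret prob_space P
    using assms by (simp add: ambiguity_set_def)
  have [measurable_cong]: "sets P = sets borel"
    and int: "integrable P (\<lambda>w. w)" and mean: "(\<integral>w. w \<partial>P) = 0"
    \<comment> \<open>Since the mean is 0, the centred moments are plain second moments.\<close>
    and cov: "\<And>i j. integrable P (\<lambda>w. w $ i * w $ j)"
      "\<And>i j. (\<integral>w. w $ i * w $ j \<partial>P) = S $ i $ j"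
    using assms by (auto simp: ambiguity_set_def has_mean_def has_covariance_def)
  have [measurable]: "(\<lambda>w. w $ i) \<in> borel_measurable borel" for i :: 'a
    by (intro borel_measurable_continuous_onI continuous_intros)
  have uminus[measurable]: "(uminus :: real^'a \<Rightarrow> real^'a) \<in> measurable P borel"
    by measurable
  have "prob_space (distr P borel uminus)"
    by (rule prob_space_distr) (rule uminus)
  moreover have mean': "has_mean (distr P borel uminus) 0"
  proof -
    have "integrable (distr P borel uminus) (\<lambda>w. w)"
      using integrable_minus[OF int] by (simp only: integrable_distr_eq[OF uminus measurable_ident_sets[OF refl]])
    moreover have "(\<integral>w. w \<partial>distr P borel uminus) = - (\<integral>w. w \<partial>P)"
      by (simp only: integral_distr[OF uminus measurable_ident_sets[OF refl]] integral_minus)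
    ultimately show ?thesis
      by (simp add: has_mean_def mean)
  qed
  \<comment> \<open>\<open>mean'\<close> makes the centring vector of the reflected law 0 as well,
    so \<open>cov\<close> applies after the change of variables.\<close>
  moreover have "has_covariance (distr P borel uminus) S"
    using mean' cov
    by (simp add: has_covariance_def has_mean_def integrable_distr_eq integral_distr)
  ultimately show ?thesis
    by (simp add: ambiguity_set_def)
qed

lemma cvar_distr:
  assumes [measurable]: "T \<in> measurable P borel" "L \<in> borel_measurable borel"
  shows "cvar (distr P borel T) \<epsilon> L = cvar P \<epsilon> (\<lambda>w. L (T w))"
  by (simp add: cvar_def nn_integral_distr)

text \<open>Each \<open>P\<close> is matched with its reflection, which stays in the set and gives
  \<open>L\<close> the CVaR that \<open>P\<close> gives the reflected loss.\<close>

lemma wc_cvar_uminus_le: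
  assumes L[measurable]: "L \<in> borel_measurable borel"
  shows "wc_cvar (ambiguity_set S) \<epsilon> (\<lambda>w. L (- w)) \<le> wc_cvar (ambiguity_set S) \<epsilon> L"
  unfolding wc_cvar_def
proof (rule SUP_mono)
  fix P assume P: "P \<in> ambiguity_set S"
  then have [measurable_cong]: "sets P = sets borel"
    by (simp add: ambiguity_set_def)
  have "cvar (distr P borel uminus) \<epsilon> L = cvar P \<epsilon> (\<lambda>w. L (- w))"
    by (rule cvar_distr) measurable
  then show "\<exists>Q\<in>ambiguity_set S. cvar P \<epsilon> (\<lambda>w. L (- w)) \<le> cvar Q \<epsilon> L"
    using distr_uminus_ambiguity_set[OF P] by (metis order_refl)
qed

text \<open>Reflection is an involution: the inequality for the loss \<open>L (- w)\<close> is the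
  converse one.\<close>

lemma wc_cvar_uminus:
  assumes L[measurable]: "L \<in> borel_measurable borel"
  shows "wc_cvar (ambiguity_set S) \<epsilon> (\<lambda>w. L (- w)) = wc_cvar (ambiguity_set S) \<epsilon> L"
  using wc_cvar_uminus_le[OF L] wc_cvar_uminus_le[of "\<lambda>w. L (- w)"]
  by (intro antisym) simp_all

theorem mainTheorem4:
  fixes f :: "real^'n \<Rightarrow> real^'n"
    and g :: "real^'n \<Rightarrow> real^'m^'n"
    and \<epsilon> \<alpha> r :: real
    and \<Sigma>\<^sub>w :: "real^'n^'n"
    and \<P> :: "(real^'n) measure set"
    and q :: "real^'n"
    and h :: "real^'n \<Rightarrow> real"
    and \<phi> :: "real^'n \<Rightarrow> ereal"
  assumes "continuous_on UNIV f" and "continuous_on UNIV g"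
    and "0 < \<epsilon>" and "\<epsilon> < 1"
    and "0 \<le> \<alpha>" and "\<alpha> \<le> 1"
    and "pos_def_mat \<Sigma>\<^sub>w"
    and "\<P> = ambiguity_set \<Sigma>\<^sub>w"
    and "h = (\<lambda>x. q \<bullet> x + r)"
    and "\<phi> = (\<lambda>x. ereal (q \<bullet> (f x - \<alpha> *\<^sub>R x) + (1 - \<alpha>) * r) - wc_cvar \<P> \<epsilon> (\<lambda>w. q \<bullet> w))"
  shows "\<forall>(x :: real^'n) (u :: real^'m).
           wc_cvar \<P> \<epsilon> (\<lambda>w. - h (next_state f g x u w)) \<le> ereal (- \<alpha> * h x)
           \<longleftrightarrow> ereal (- (q \<bullet> (g x *v u))) \<le> \<phi> x"
proof (intro allI)
  fix x :: "real^'n" and u :: "real^'m"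
  \<comment> \<open>The deterministic part of the loss; what remains of it is
    \<open>q \<bullet> (- w)\<close>.\<close>
  define c where "c = - (q \<bullet> f x + q \<bullet> (g x *v u) + r)"
  let ?W = "wc_cvar \<P> \<epsilon> (\<lambda>w. q \<bullet> w)"
  have "wc_cvar \<P> \<epsilon> (\<lambda>w. - h (next_state f g x u w)) \<le> ereal (- \<alpha> * h x) \<longleftrightarrow>
      wc_cvar \<P> \<epsilon> (\<lambda>w. q \<bullet> (- w) + c) \<le> ereal (- \<alpha> * h x)"
    by (simp add: assms(9) next_state_def c_def algebra_simps)
  also have "\<dots> \<longleftrightarrow> wc_cvar \<P> \<epsilon> (\<lambda>w. q \<bullet> (- w)) \<le> ereal (- \<alpha> * h x - c)"
    by (rule wc_cvar_add_const_le_iff)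
  also have "wc_cvar \<P> \<epsilon> (\<lambda>w. q \<bullet> (- w)) = ?W"
    unfolding assms(8) by (rule wc_cvar_uminus) measurable
  \<comment> \<open>The bound equals \<open>q \<bullet> (f x - \<alpha> *\<^sub>R x) + (1 -
    \<alpha>) * r + q \<bullet> (g x *v u)\<close>. The case split on \<open>?W\<close> covers
    infinite values: both sides fail at \<infinity> and both hold at -\<infinity>.\<close>
  also have "?W \<le> ereal (- \<alpha> * h x - c) \<longleftrightarrow> ereal (- (q \<bullet> (g x *v u))) \<le> \<phi> x"
    unfolding assms(9,10) c_def
    by (cases ?W) (auto simp: algebra_simps)
  finally show "wc_cvar \<P> \<epsilon> (\<lambda>w. - h (next_state f g x u w)) \<le> ereal (- \<alpha> * h x)
      \<longleftrightarrow> ereal (- (q \<bullet> (g x *v u))) \<le> \<phi> x" .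
qed

end
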